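(* Let $n,d\ge 1$, let $a_1,\dots,a_n\in\mathbb{R}^d$, let $\omega_1,\dots,\omega_n\ge 0$, let $\lambda_1\ge\dots\ge\lambda_n\ge 0$, and let $\tau=\frac{r}{s}$ with $r,s\in\mathbb{N}\setminus\{0\}$, $r>s$ and $\gcd(r,s)=1$. Then the ordered median problem $$\min_{x\in\mathbb{R}^d} f_\lambda(x),\qquad f_\lambda(x)=\sum_{i=1}^n\lambda_i\,\omega_{\sigma(i)}\|x-a_{\sigma(i)}\|_\tau ,$$ where $\sigma=\sigma_x$ is a permutation of $\{1,\dots,n\}$ with $\omega_{\sigma(1)}\|x-a_{\sigma(1)}\|_\tau\ge\dots\ge\omega_{\sigma(n)}\|x-a_{\sigma(n)}\|_\tau$, can be represented as a semidefinite programming problem with $n^2+n(2d+1)$ linear constraints and at most $4nd\log_2 r$ positive semidefinite constraints.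
   Context: For $\tau\ge1$, $\|x\|_\tau=\big(\sum_{j=1}^d|x_j|^\tau\big)^{1/\tau}$. The value $f_\lambda(x)$ does not depend on the choice of the sorting permutation $\sigma_x$. A semidefinite programming problem here is the minimization of a linear function over finitely many real variables subject to finitely many linear inequalities ("linear constraints") and finitely many linear matrix inequalities of the form "a symmetric matrix whose entries are affine functions of the variables is positive semidefinite" ("positive semidefinite constraints"). Saying that $\min_{x}f_\lambda(x)$ is represented as such a problem means that the semidefinite problem has variables $(x,\eta)$, where $\eta$ is a finite vector of auxiliary variables, and for every $x\in\mathbb{R}^d$ the infimum of its linear objective over all $\eta$ with $(x,\eta)$ feasible equals $f_\lambda(x)$. *)

theory Defs
  imports
    "HOL-Library.Extended_Real"
    "HOL-Combinatorics.Permutations"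
    "Jordan_Normal_Form.Matrix"
begin

section \<open>Ordered median functions\<close>

definition ltau_norm :: "real \<Rightarrow> real vec \<Rightarrow> real" where
  "ltau_norm \<tau> x = (\<Sum>j<dim_vec x. \<bar>x $ j\<bar> powr \<tau>) powr (1 / \<tau>)"

definition sorts_desc :: "nat \<Rightarrow> (nat \<Rightarrow> real) \<Rightarrow> (nat \<Rightarrow> nat) \<Rightarrow> bool" where
  "sorts_desc n w \<sigma> \<longleftrightarrow>
     \<sigma> permutes {1..n} \<and> (\<forall>i\<in>{1..n}. \<forall>j\<in>{1..n}. i \<le> j \<longrightarrow> w (\<sigma> j) \<le> w (\<sigma> i))"

text \<open>The sorting permutation is not unique; any choice gives the same value, see
  \<open>ordered_median_eq\<close> below.\<close>

definition ordered_median ::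
  "nat \<Rightarrow> real \<Rightarrow> (nat \<Rightarrow> real vec) \<Rightarrow> (nat \<Rightarrow> real) \<Rightarrow> (nat \<Rightarrow> real) \<Rightarrow> real vec \<Rightarrow> real" where
  "ordered_median n \<tau> a \<omega> lam x =
     (let \<sigma> = (SOME \<sigma>. sorts_desc n (\<lambda>i. \<omega> i * ltau_norm \<tau> (x - a i)) \<sigma>)
      in \<Sum>i=1..n. lam i * \<omega> (\<sigma> i) * ltau_norm \<tau> (x - a (\<sigma> i)))"

lemma sorts_desc_exists: "\<exists>\<sigma>. sorts_desc n w \<sigma>"
proof -
  define xs where "xs = rev (sort_key w [1..<Suc n])"
  define \<sigma> where "\<sigma> i = (if i \<in> {1..n} then xs ! (i - 1) else i)" for i
  have len: "length xs = n" by (simp add: xs_def)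
  have dist: "distinct xs" by (simp add: xs_def)
  have set: "set xs = {1..n}" by (auto simp: xs_def)
  have inj: "inj_on \<sigma> {1..n}"
    using dist len by (auto simp: inj_on_def \<sigma>_def nth_eq_iff_index_eq)
  have img: "\<sigma> ` {1..n} \<subseteq> {1..n}"
  proof
    fix y assume "y \<in> \<sigma> ` {1..n}"
    then obtain i where i: "i \<in> {1..n}" "y = xs ! (i - 1)" by (auto simp: \<sigma>_def)
    then have "i - 1 < length xs" using len by auto
    then show "y \<in> {1..n}" using i set nth_mem by blast
  qed
  have "\<sigma> permutes {1..n}"
    using inj img endo_inj_surj[of "{1..n}" \<sigma>]
    by (intro bij_imp_permutes) (auto simp: bij_betw_def \<sigma>_def)
  moreover have "w (\<sigma> j) \<le> w (\<sigma> i)" if "i \<in> {1..n}" "j \<in> {1..n}" "i \<le> j" for i j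
  proof -
    have "sorted (rev (map w xs))" by (simp add: xs_def rev_map del: upt_Suc)
    then have "map w xs ! (j - 1) \<le> map w xs ! (i - 1)"
      using that len by (intro sorted_rev_nth_mono) auto
    then show ?thesis using that len by (simp add: \<sigma>_def)
  qed
  ultimately show ?thesis unfolding sorts_desc_def by blast
qed

lemma sorts_desc_unique:
  assumes "sorts_desc n w \<sigma>" "sorts_desc n w \<rho>" "i \<in> {1..n}"
  shows "w (\<sigma> i) = w (\<rho> i)"
proof -
  define L where "L \<pi> = map (\<lambda>k. w (\<pi> (Suc k))) [0..<n]" for \<pi>
  have srt: "sorted (rev (L \<pi>))" if "sorts_desc n w \<pi>" for \<pi>
    using that unfolding sorted_rev_iff_nth_mono by (auto simp: L_def sorts_desc_def)
  have ms: "mset (L \<pi>) = image_mset w (mset_set {1..n})" if "sorts_desc n w \<pi>" for \<pi>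
  proof -
    have p: "\<pi> permutes {1..n}" using that by (simp add: sorts_desc_def)
    have "bij_betw (\<lambda>k. \<pi> (Suc k)) {0..<n} {1..n}"
      using bij_betw_trans[OF _ permutes_imp_bij[OF p], of Suc "{0..<n}"]
      by (simp add: bij_betw_def o_def image_Suc_atLeastLessThan atLeastLessThanSuc_atLeastAtMost)
    then have "image_mset (\<lambda>k. \<pi> (Suc k)) (mset_set {0..<n}) = mset_set {1..n}"
      by (simp add: bij_betw_def image_mset_mset_set)
    then have "image_mset w (image_mset (\<lambda>k. \<pi> (Suc k)) (mset_set {0..<n})) =
        image_mset w (mset_set {1..n})"
      by (rule arg_cong)
    then show ?thesis
      by (simp add: L_def image_mset.compositionality o_def)
  qed
  have "rev (L \<sigma>) = rev (L \<rho>)"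
    using srt ms assms by (metis mset_rev properties_for_sort)
  then have "L \<sigma> ! (i - 1) = L \<rho> ! (i - 1)" by simp
  then show ?thesis using assms(3) by (auto simp: L_def)
qed

lemma ordered_median_eq:
  assumes "sorts_desc n (\<lambda>i. \<omega> i * ltau_norm \<tau> (x - a i)) \<sigma>"
  shows "ordered_median n \<tau> a \<omega> lam x =
    (\<Sum>i=1..n. lam i * \<omega> (\<sigma> i) * ltau_norm \<tau> (x - a (\<sigma> i)))"
proof -
  let ?w = "\<lambda>i. \<omega> i * ltau_norm \<tau> (x - a i)"
  have "sorts_desc n ?w (SOME \<sigma>. sorts_desc n ?w \<sigma>)"
    by (rule someI[of "sorts_desc n ?w", OF assms])
  from sorts_desc_unique[OF this assms] show ?thesis
    by (simp add: ordered_median_def Let_def mult.assoc)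
qed


section \<open>Semidefinite programming problems\<close>

text \<open>The pair \<open>(q, c)\<close> stands for the affine function \<open>z \<mapsto> q \<bullet> z + c\<close>.\<close>

type_synonym affine_fun = "real vec \<times> real"

definition affine_eval :: "affine_fun \<Rightarrow> real vec \<Rightarrow> real" where
  "affine_eval g z = fst g \<bullet> z + snd g"

definition psd_mat :: "real mat \<Rightarrow> bool" where
  "psd_mat A \<longleftrightarrow> square_mat A \<and> A\<^sup>T = A \<and>
     (\<forall>v\<in>carrier_vec (dim_row A). 0 \<le> v \<bullet> (A *\<^sub>v v))"

record sdp =
  num_vars :: nat
  objective :: "real vec"
  linear_cons :: "affine_fun list"
  psd_cons :: "affine_fun mat list"

definition wf_sdp :: "sdp \<Rightarrow> bool" where
  "wf_sdp P \<longleftrightarrow>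
     objective P \<in> carrier_vec (num_vars P) \<and>
     (\<forall>g\<in>set (linear_cons P). fst g \<in> carrier_vec (num_vars P)) \<and>
     (\<forall>M\<in>set (psd_cons P). square_mat M \<and> M\<^sup>T = M \<and>
        (\<forall>g\<in>elements_mat M. fst g \<in> carrier_vec (num_vars P)))"

definition sdp_feasible :: "sdp \<Rightarrow> real vec \<Rightarrow> bool" where
  "sdp_feasible P z \<longleftrightarrow>
     z \<in> carrier_vec (num_vars P) \<and>
     (\<forall>g\<in>set (linear_cons P). 0 \<le> affine_eval g z) \<and>
     (\<forall>M\<in>set (psd_cons P). psd_mat (map_mat (\<lambda>g. affine_eval g z) M))"

text \<open>The first \<open>d\<close> variables are \<open>x\<close>, the remaining ones are the auxiliary variables \<open>\<eta>\<close>.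
  The infimum is taken in the extended reals, so that equality with a real number entails that
  some \<open>(x, \<eta>)\<close> is feasible and that the objective is bounded below.\<close>

definition sdp_represents :: "nat \<Rightarrow> (real vec \<Rightarrow> real) \<Rightarrow> sdp \<Rightarrow> bool" where
  "sdp_represents d f P \<longleftrightarrow>
     (\<exists>m. num_vars P = d + m \<and>
       (\<forall>x\<in>carrier_vec d.
          (INF \<eta>\<in>{\<eta> \<in> carrier_vec m. sdp_feasible P (x @\<^sub>v \<eta>)}. ereal (objective P \<bullet> (x @\<^sub>v \<eta>)))
            = ereal (f x)))"

end

(* In epigraph form t_i bounds omega_i ||x - a_i||. Minimizing sum u_i + sum w_k subject to
   u_i + w_k >= lam_k t_i is the dual of the assignment problem, whose value is the ordered sum of the
   t_i because lam is nonincreasing; this costs n^2 linear constraints. The norm bound splits into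
   v_ij >= |omega_i (x_j - a_ij)|, sum_j b_ij <= t_i (n (2 d + 1) linear constraints) and the power cones
   v_ij^r <= b_ij^s t_i^(r-s). If r - 1 <= 2^K, such a cone is given by v^2 <= g h, where g and h are
   2^K-th roots of b^s v^(2^K - s) and of t^(r-s) v^(2^K - r + s), each obtained by K successive
   geometric means. This takes 2 K + 1 <= 4 log_2 r positive semidefinite 2 x 2 blocks. *)
theory Submission
  imports Defs
begin

section \<open>Programs over named variables\<close>

definition form_eval :: "('k \<Rightarrow> real) \<Rightarrow> (real \<times> 'k) list \<times> real \<Rightarrow> real" where
  "form_eval val g = (\<Sum>(c, k)\<leftarrow>fst g. c * val k) + snd g"

text \<open>Coefficients at equal indices are added, so a name may occur several times in one
  form.\<close>

definition form_to_affine :: "nat \<Rightarrow> ('k \<Rightarrow> nat) \<Rightarrow> (real \<times> 'k) list \<times> real \<Rightarrow> affine_fun" where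
  "form_to_affine N idx g = (vec N (\<lambda>i. \<Sum>(c, k)\<leftarrow>fst g. if idx k = i then c else 0), snd g)"

text \<open>Agreement of \<open>z\<close> and \<open>val\<close> is asked only for names that occur
  in the form, since the type of names may be infinite while \<open>z\<close> has finitely many
  coordinates.\<close>

lemma affine_eval_form_to_affine:
  assumes "z \<in> carrier_vec N"
    and "\<forall>k\<in>snd ` set (fst g). idx k < N \<and> z $ idx k = val k"
  shows "affine_eval (form_to_affine N idx g) z = form_eval val g"
proof -
  have "(\<Sum>i = 0..<N. (\<Sum>(c, k)\<leftarrow>l. if idx k = i then c else 0) * z $ i) = (\<Sum>(c, k)\<leftarrow>l. c * val k)"
    if "\<forall>k\<in>snd ` set l. idx k < N \<and> z $ idx k = val k" for l
    using that
  proof (induction l)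
    case Nil
    then show ?case by simp
  next
    case (Cons b l)
    obtain c k where b: "b = (c, k)" by (cases b)
    have k: "idx k < N" "z $ idx k = val k" using Cons.prems b by auto
    have "(\<Sum>i = 0..<N. (if idx k = i then c else 0) * z $ i)
        = (\<Sum>i = 0..<N. if idx k = i then c * z $ i else 0)"
      by (intro sum.cong) auto
    also have "\<dots> = c * val k" using k by simp
    finally show ?case
      using Cons by (simp add: b distrib_right sum.distrib)
  qed
  from this[OF assms(2)] assms(1) show ?thesis
    by (simp add: affine_eval_def form_to_affine_def form_eval_def scalar_prod_def)
qed

lemma form_to_affine_carrier [simp]: "fst (form_to_affine N idx g) \<in> carrier_vec N"
  by (simp add: form_to_affine_def)

section \<open>Positive semidefinite 2 x 2 matrices\<close>

definition sym2 :: "'a \<Rightarrow> 'a \<Rightarrow> 'a \<Rightarrow> 'a mat" where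
  "sym2 p q w = mat 2 2 (\<lambda>(i, j). if i = j then if i = 0 then p else q else w)"

lemma sym2_simps [simp]:
  "square_mat (sym2 p q w)" "(sym2 p q w)\<^sup>T = sym2 p q w"
  by (auto simp: sym2_def)

lemma elements_mat_sym2: "elements_mat (sym2 p q w) \<subseteq> {p, q, w}"
  by (auto simp: sym2_def elements_mat_def)

lemma map_mat_sym2: "map_mat f (sym2 p q w) = sym2 (f p) (f q) (f w)"
  by (auto simp: sym2_def)

text \<open>The rotated quadratic cone: nonnegative diagonal and determinant of the symmetric matrix
  with diagonal \<open>p\<close>, \<open>q\<close> and off-diagonal entry \<open>w\<close>.\<close>

definition hyperbolic :: "real \<Rightarrow> real \<Rightarrow> real \<Rightarrow> bool" where
  "hyperbolic p q w \<longleftrightarrow> 0 \<le> p \<and> 0 \<le> q \<and> w\<^sup>2 \<le> p * q"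

text \<open>Unit vectors give the signs of the diagonal and \<open>(- w, p)\<close> gives
  \<open>p\<close> times the determinant; the converse completes the square. The case
  \<open>p = 0\<close> is separate in both directions.\<close>

lemma psd_mat_sym2: "psd_mat (sym2 p q w) \<longleftrightarrow> hyperbolic p q w"
proof -
  have quad: "v \<bullet> (sym2 p q w *\<^sub>v v) = p * (v $ 0)\<^sup>2 + 2 * w * v $ 0 * v $ 1 + q * (v $ 1)\<^sup>2"
    if "v \<in> carrier_vec 2" for v
  proof -
    have v: "dim_vec v = 2" and two: "{0..<2::nat} = {0, 1}" using that by auto
    have "(sym2 p q w *\<^sub>v v) $ 0 = p * v $ 0 + w * v $ 1"
      "(sym2 p q w *\<^sub>v v) $ 1 = w * v $ 0 + q * v $ 1"
      "dim_vec (sym2 p q w *\<^sub>v v) = 2"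
      by (simp_all add: sym2_def scalar_prod_def v two)
    then have "v \<bullet> (sym2 p q w *\<^sub>v v) = v $ 0 * (p * v $ 0 + w * v $ 1) + v $ 1 * (w * v $ 0 + q * v $ 1)"
      by (simp only: scalar_prod_def two) simp
    then show ?thesis by (simp add: algebra_simps power2_eq_square)
  qed
  have dim: "dim_row (sym2 p q w) = 2" by (simp add: sym2_def)
  show ?thesis
  proof
    assume "psd_mat (sym2 p q w)"
    then have form: "0 \<le> p * (v $ 0)\<^sup>2 + 2 * w * v $ 0 * v $ 1 + q * (v $ 1)\<^sup>2" if "v \<in> carrier_vec 2" for v
      using that unfolding psd_mat_def dim quad[OF that, symmetric] by blast
    have *: "0 \<le> p * \<alpha>\<^sup>2 + 2 * w * \<alpha> * \<beta> + q * \<beta>\<^sup>2" for \<alpha> \<beta>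
      using form[of "vec 2 (\<lambda>i. if i = 0 then \<alpha> else \<beta>)"] by simp
    have p: "0 \<le> p" and q: "0 \<le> q" using *[of 1 0] *[of 0 1] by auto
    have "w\<^sup>2 \<le> p * q"
    proof (cases "p = 0")
      case True
      \<comment> \<open>With \<open>p = 0\<close>, the vector \<open>(- (q + 1), w)\<close> has form
        value \<open>- (q + 2) * w^2\<close>, which forces \<open>w = 0\<close>.\<close>
      have "(q + 2) * w\<^sup>2 \<le> 0"
        using *[of "- (q + 1)" w] True by (simp add: power2_eq_square algebra_simps)
      then have "w\<^sup>2 \<le> 0" using q by (simp add: mult_le_0_iff)
      then show ?thesis using True by simp
    next
      case False
      have "0 \<le> p * (p * q - w\<^sup>2)" using *[of "- w" p] by (simp add: algebra_simps power2_eq_square)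
      then show ?thesis using False p by (simp add: zero_le_mult_iff)
    qed
    with p q show "hyperbolic p q w" by (simp add: hyperbolic_def)
  next
    assume h: "hyperbolic p q w"
    have "0 \<le> p * \<alpha>\<^sup>2 + 2 * w * \<alpha> * \<beta> + q * \<beta>\<^sup>2" for \<alpha> \<beta>
    proof (cases "p = 0")
      case True
      then show ?thesis using h by (simp add: hyperbolic_def)
    next
      case False
      \<comment> \<open>Scaling by \<open>p > 0\<close> completes the square without a
        division.\<close>
      have "p * (p * \<alpha>\<^sup>2 + 2 * w * \<alpha> * \<beta> + q * \<beta>\<^sup>2) = (p * \<alpha> + w * \<beta>)\<^sup>2 + (p * q - w\<^sup>2) * \<beta>\<^sup>2"
        by (simp add: algebra_simps power2_eq_square)
      also have "\<dots> \<ge> 0" using h by (simp add: hyperbolic_def)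
      finally show ?thesis using False h by (simp add: hyperbolic_def zero_le_mult_iff)
    qed
    then show "psd_mat (sym2 p q w)"
      using sym2_simps(1)[of p q w] by (simp add: psd_mat_def dim quad)
  qed
qed

section \<open>From named variables to coordinate vectors\<close>

definition feasible_values ::
  "((real \<times> 'k) list \<times> real) list \<Rightarrow> ('k \<times> 'k \<times> 'k) list \<Rightarrow> ('k \<Rightarrow> real) \<Rightarrow> bool" where
  "feasible_values lin psd val \<longleftrightarrow>
     (\<forall>g\<in>set lin. 0 \<le> form_eval val g) \<and>
     (\<forall>(p, q, w)\<in>set psd. hyperbolic (val p) (val q) (val w))"

text \<open>Allows programs to be written with named variables: \<open>Inl j\<close> is the
  coordinate \<open>j\<close> of \<open>x\<close>, \<open>Inr k\<close> an auxiliary variable. Only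
  finitely many names occur, so they can be numbered. A lower bound on all feasible values together
  with a feasible valuation reaching it determines the infimum, and each form or triple becomes
  exactly one constraint.\<close>

lemma sdp_representation_of_named_program:
  fixes lin :: "((real \<times> (nat + 'k)) list \<times> real) list"
    and psd :: "((nat + 'k) \<times> (nat + 'k) \<times> (nat + 'k)) list"
    and obj :: "(real \<times> (nat + 'k)) list"
  defines "Ks \<equiv> (\<Union>g\<in>set lin. snd ` set (fst g)) \<union> (\<Union>(p, q, w)\<in>set psd. {p, q, w}) \<union> snd ` set obj"
  assumes vars: "\<And>j. Inl j \<in> Ks \<Longrightarrow> j < d"
    and lower: "\<And>x e. x \<in> carrier_vec d \<Longrightarrow> feasible_values lin psd (case_sum (($) x) e) \<Longrightarrow>
       f x \<le> form_eval (case_sum (($) x) e) (obj, 0)"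
    and attained: "\<And>x. x \<in> carrier_vec d \<Longrightarrow>
       \<exists>e. feasible_values lin psd (case_sum (($) x) e) \<and> form_eval (case_sum (($) x) e) (obj, 0) \<le> f x"
  shows "\<exists>P. wf_sdp P \<and> sdp_represents d f P \<and>
     length (linear_cons P) = length lin \<and> length (psd_cons P) = length psd"
proof -
  have fin: "finite (Inr -` Ks)"
    by (rule finite_vimageI) (auto simp: Ks_def)
  then obtain h :: "'k \<Rightarrow> nat" where h: "bij_betw h (Inr -` Ks) {0..<card (Inr -` Ks :: 'k set)}"
    using ex_bij_betw_finite_nat by blast
  define m where "m = card (Inr -` Ks :: 'k set)"
  define idx where "idx = case_sum (\<lambda>j. j) (\<lambda>k. d + h k)"
  have idx: "idx k < d + m" if "k \<in> Ks" for k
  proof (cases k)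
    case (Inl j)
    then show ?thesis using that vars by (auto simp: idx_def trans_less_add1)
  next
    case (Inr k')
    then have "h k' \<in> {0..<m}" using that bij_betwE[OF h] by (auto simp: m_def)
    then show ?thesis by (simp add: idx_def Inr)
  qed
  define conv where "conv = form_to_affine (d + m) idx"
  define var where "var k = conv ([(1, k)], 0)" for k
  define P where "P = \<lparr>num_vars = d + m, objective = fst (conv (obj, 0)),
     linear_cons = map conv lin, psd_cons = map (\<lambda>(p, q, w). sym2 (var p) (var q) (var w)) psd\<rparr>"
  have conv_carrier: "fst (conv g) \<in> carrier_vec (d + m)" for g by (simp add: conv_def)
  have wf: "wf_sdp P"
  proof -
    have "square_mat M \<and> M\<^sup>T = M \<and> (\<forall>g\<in>elements_mat M. fst g \<in> carrier_vec (num_vars P))"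
      if M: "M \<in> set (psd_cons P)" for M
    proof -
      obtain p q w where M': "M = sym2 (var p) (var q) (var w)"
        using M unfolding P_def by auto
      have "fst g \<in> carrier_vec (num_vars P)" if "g \<in> elements_mat M" for g
      proof -
        have "g \<in> {var p, var q, var w}" using that elements_mat_sym2[of "var p" "var q" "var w"] unfolding M' by (rule_tac subsetD)
        then show ?thesis unfolding P_def var_def using conv_carrier by auto
      qed
      moreover have "square_mat M" "M\<^sup>T = M" unfolding M' by (rule sym2_simps)+
      ultimately show ?thesis by blast
    qed
    moreover have "objective P \<in> carrier_vec (num_vars P)"
      unfolding P_def using conv_carrier by simp
    moreover have "\<forall>g\<in>set (linear_cons P). fst g \<in> carrier_vec (num_vars P)"
      unfolding P_def using conv_carrier by auto
    ultimately show ?thesis unfolding wf_sdp_def by blast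
  qed
  \<comment> \<open>Stated for any vector and valuation that agree on the occurring names, so that
    it serves both inequalities for the infimum.\<close>
  have feas: "sdp_feasible P z \<longleftrightarrow> feasible_values lin psd val"
    and obj: "objective P \<bullet> z = form_eval val (obj, 0)"
    if z: "z \<in> carrier_vec (d + m)" and val: "\<And>k. k \<in> Ks \<Longrightarrow> z $ idx k = val k" for z val
  proof -
    have ev: "affine_eval (conv g) z = form_eval val g" if "snd ` set (fst g) \<subseteq> Ks" for g
      unfolding conv_def using that idx val z by (intro affine_eval_form_to_affine) auto
    have evv: "affine_eval (var k) z = val k" if "k \<in> Ks" for k
      unfolding var_def using that by (subst ev) (auto simp: form_eval_def)
    have lin: "affine_eval (conv g) z = form_eval val g" if "g \<in> set lin" for g
      using that by (intro ev) (auto simp: Ks_def)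
    have psd: "psd_mat (map_mat (\<lambda>g. affine_eval g z) (sym2 (var p) (var q) (var w)))
        \<longleftrightarrow> hyperbolic (val p) (val q) (val w)" if "(p, q, w) \<in> set psd" for p q w
    proof -
      have "p \<in> Ks" "q \<in> Ks" "w \<in> Ks" using that by (force simp: Ks_def)+
      then show ?thesis by (simp add: map_mat_sym2 psd_mat_sym2 evv)
    qed
    show "sdp_feasible P z \<longleftrightarrow> feasible_values lin psd val"
    proof -
      have "(\<forall>g\<in>set (linear_cons P). 0 \<le> affine_eval g z) \<longleftrightarrow> (\<forall>g\<in>set lin. 0 \<le> form_eval val g)"
        using lin by (simp add: P_def)
      moreover have "(\<forall>M\<in>set (psd_cons P). psd_mat (map_mat (\<lambda>g. affine_eval g z) M)) \<longleftrightarrow>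
          (\<forall>(p, q, w)\<in>set psd. hyperbolic (val p) (val q) (val w))"
        using psd by (auto simp: P_def)
      moreover have "z \<in> carrier_vec (num_vars P)" using z by (simp add: P_def)
      ultimately show ?thesis unfolding sdp_feasible_def feasible_values_def by blast
    qed
    have "affine_eval (conv (obj, 0)) z = form_eval val (obj, 0)"
      by (rule ev) (auto simp: Ks_def)
    then show "objective P \<bullet> z = form_eval val (obj, 0)"
      by (simp add: P_def affine_eval_def conv_def form_to_affine_def)
  qed
  have "(INF \<eta>\<in>{\<eta> \<in> carrier_vec m. sdp_feasible P (x @\<^sub>v \<eta>)}. ereal (objective P \<bullet> (x @\<^sub>v \<eta>)))
      = ereal (f x)" (is "?I = _") if x: "x \<in> carrier_vec d" for x
  proof (rule antisym)
    obtain e where e: "feasible_values lin psd (case_sum (($) x) e)"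
        "form_eval (case_sum (($) x) e) (obj, 0) \<le> f x"
      using attained[OF x] by blast
    define \<eta> where "\<eta> = vec m (\<lambda>i. e (inv_into (Inr -` Ks) h i))"
    have val: "(x @\<^sub>v \<eta>) $ idx k = case_sum (($) x) e k" if "k \<in> Ks" for k
    proof (cases k)
      case (Inl j)
      then show ?thesis using that vars x by (simp add: idx_def \<eta>_def trans_less_add1)
    next
      case (Inr k')
      then have k': "k' \<in> Inr -` Ks" using that by simp
      then have "h k' < m" using bij_betwE[OF h] by (auto simp: m_def)
      moreover have "inv_into (Inr -` Ks) h (h k') = k'"
        using h k' by (simp add: bij_betw_def inv_into_f_f)
      ultimately show ?thesis using x by (simp add: idx_def \<eta>_def Inr)
    qed
    have c: "x @\<^sub>v \<eta> \<in> carrier_vec (d + m)" "\<eta> \<in> carrier_vec m" using x by (auto simp: \<eta>_def)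
    have "?I \<le> ereal (objective P \<bullet> (x @\<^sub>v \<eta>))"
      using feas[OF c(1) val] e(1) c(2) by (intro INF_lower) auto
    also have "\<dots> \<le> ereal (f x)" using obj[OF c(1) val] e(2) by simp
    finally show "?I \<le> ereal (f x)" .
  next
    show "ereal (f x) \<le> ?I"
    proof (rule INF_greatest)
      fix \<eta> assume "\<eta> \<in> {\<eta> \<in> carrier_vec m. sdp_feasible P (x @\<^sub>v \<eta>)}"
      then have \<eta>: "\<eta> \<in> carrier_vec m" "sdp_feasible P (x @\<^sub>v \<eta>)" by auto
      \<comment> \<open>For names outside \<open>Ks\<close> this value is arbitrary; no constraint
        mentions them.\<close>
      define e where "e k = (x @\<^sub>v \<eta>) $ (d + h k)" for k
      have val: "(x @\<^sub>v \<eta>) $ idx k = case_sum (($) x) e k" if "k \<in> Ks" for k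
        using that vars x \<eta> by (cases k) (auto simp: idx_def e_def trans_less_add1)
      have c: "x @\<^sub>v \<eta> \<in> carrier_vec (d + m)" using x \<eta> by auto
      show "ereal (f x) \<le> ereal (objective P \<bullet> (x @\<^sub>v \<eta>))"
        using lower[OF x, of e] feas[OF c val] obj[OF c val] \<eta>(2) by simp
    qed
  qed
  then have "sdp_represents d f P"
    by (auto simp: sdp_represents_def P_def)
  with wf show ?thesis by (intro exI[of _ P]) (simp add: P_def)
qed


section \<open>Ordered weighted sums as assignment duals\<close>

text \<open>Weak duality: add the inequalities for the pairs \<open>(\<sigma> k, k)\<close>. Any
  permutation will do, sorted or not.\<close>

lemma ordered_sum_le_assignment_dual:
  fixes lam t :: "nat \<Rightarrow> real"
  assumes "\<sigma> permutes {1..n}"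
    and "\<And>i k. i \<in> {1..n} \<Longrightarrow> k \<in> {1..n} \<Longrightarrow> lam k * t i \<le> u i + w k"
  shows "(\<Sum>k=1..n. lam k * t (\<sigma> k)) \<le> (\<Sum>i=1..n. u i) + (\<Sum>k=1..n. w k)"
proof -
  have "(\<Sum>k=1..n. lam k * t (\<sigma> k)) \<le> (\<Sum>k=1..n. u (\<sigma> k) + w k)"
    using assms permutes_in_image[OF assms(1)] by (intro sum_mono) auto
  also have "\<dots> = (\<Sum>i=1..n. u i) + (\<Sum>k=1..n. w k)"
    using sum.permute[OF assms(1), of u] by (simp add: sum.distrib o_def)
  finally show ?thesis .
qed

text \<open>Pairing two sequences in the same order is an optimal assignment. The potentials make
  the inequalities tight exactly along that pairing, so the dual value equals the ordered
  sum.\<close>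

lemma assignment_dual_attained:
  fixes lam t :: "nat \<Rightarrow> real"
  assumes lam: "\<forall>i\<in>{1..n}. \<forall>j\<in>{1..n}. i \<le> j \<longrightarrow> lam j \<le> lam i"
    and \<sigma>: "sorts_desc n t \<sigma>"
  obtains u w where "\<And>i k. i \<in> {1..n} \<Longrightarrow> k \<in> {1..n} \<Longrightarrow> lam k * t i \<le> u i + w k"
    and "(\<Sum>i=1..n. u i) + (\<Sum>k=1..n. w k) = (\<Sum>k=1..n. lam k * t (\<sigma> k))"
proof -
  have perm: "\<sigma> permutes {1..n}" using \<sigma> by (simp add: sorts_desc_def)
  define T where "T i = t (\<sigma> i)" for i
  have T: "T j \<le> T i" if "i \<in> {1..n}" "j \<in> {1..n}" "i \<le> j" for i j
    using \<sigma> that by (simp add: sorts_desc_def T_def)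
  \<comment> \<open>Passing from \<open>k\<close> to \<open>Suc k\<close> changes
    \<open>w k - lam k * T i\<close> by \<open>(lam k - lam (Suc k)) * (T i - T k)\<close>. This is
    nonnegative for \<open>k \<ge> i\<close> and nonpositive for \<open>k \<le> i\<close>, so the
    minimum over \<open>k\<close> is at \<open>k = i\<close>.\<close>
  define w where "w k = - (\<Sum>l=1..<k. (lam l - lam (Suc l)) * T l)" for k
  have w_Suc: "w (Suc k) = w k - (lam k - lam (Suc k)) * T k" if "1 \<le> k" for k
    using that by (simp add: w_def)
  have up: "w i - lam i * T i \<le> w k - lam k * T i" if "i \<le> k" "1 \<le> i" "k \<le> n" for i k
    using that
  proof (induction k rule: dec_induct)
    case (step k)
    have "0 \<le> (lam k - lam (Suc k)) * (T i - T k)"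
      using step.prems step.hyps lam T by (intro mult_nonneg_nonneg) auto
    then show ?case using step w_Suc[of k] by (simp add: algebra_simps)
  qed simp
  have down: "w i - lam i * T i \<le> w k - lam k * T i" if "k \<le> i" "1 \<le> k" "i \<le> n" for i k
    using that
  proof (induction k rule: inc_induct)
    case (step k)
    have "0 \<le> (lam k - lam (Suc k)) * (T k - T i)"
      using step.prems step.hyps lam T by (intro mult_nonneg_nonneg) auto
    then show ?case using step w_Suc[of k] by (simp add: algebra_simps)
  qed simp
  \<comment> \<open>Minus the minimum just described, transported back along
    \<open>\<sigma>\<close>: the smallest potential compatible with \<open>w\<close>.\<close>
  define u where "u i = (let k = inv_into UNIV \<sigma> i in lam k * T k - w k)" for i
  have u: "u (\<sigma> k) = lam k * T k - w k" for k
    using permutes_inverses[OF perm] by (simp add: u_def)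
  show thesis
  proof
    fix i k assume ik: "i \<in> {1..n}" "k \<in> {1..n}"
    obtain i' where i': "i = \<sigma> i'" using permutes_surj[OF perm] by (metis surjD)
    with ik have "i' \<in> {1..n}" using permutes_in_image[OF perm] by blast
    then show "lam k * t i \<le> u i + w k"
      using up[of i' k] down[of k i'] ik by (cases "i' \<le> k") (auto simp: i' u T_def)
  next
    have "(\<Sum>i=1..n. u i) = (\<Sum>k=1..n. u (\<sigma> k))"
      using sum.permute[OF perm, of u] by (simp add: o_def)
    then show "(\<Sum>i=1..n. u i) + (\<Sum>k=1..n. w k) = (\<Sum>k=1..n. lam k * t (\<sigma> k))"
      by (simp add: u sum_subtractf T_def)
  qed
qed


section \<open>Power cones by repeated square roots\<close>

lemma mod_power_Suc:
  "(m::nat) mod 2 ^ Suc l = m mod 2 ^ l + (if odd (m div 2 ^ l) then 2 ^ l else 0)"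
  using mod_mult2_eq[of m "2 ^ l" 2] by (auto simp: mult.commute odd_iff_mod_2_eq_one)

text \<open>The binary digits of \<open>m = p - 1\<close> decide which of \<open>b\<close> and \<open>v\<close> enters each geometric mean, so that
  \<open>K\<close> steps from \<open>b\<close> lead to \<open>b\<^sup>p v\<^sup>q\<close> with \<open>p + q = 2 ^ K\<close>, under a \<open>2 ^ K\<close>-th root. Starting from \<open>b\<close>
  accounts for one factor; this covers \<open>1 \<le> p \<le> 2 ^ K\<close> uniformly and forces \<open>b \<ge> 0\<close>.\<close>

lemma sqrt_chain_exponents:
  fixes b v :: real
  shows "(b ^ Suc (m mod 2 ^ l) * v ^ (2 ^ l - Suc (m mod 2 ^ l))) * (if odd (m div 2 ^ l) then b else v) ^ 2 ^ l
    = b ^ Suc (m mod 2 ^ Suc l) * v ^ (2 ^ Suc l - Suc (m mod 2 ^ Suc l))"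
proof -
  let ?e = "Suc (m mod 2 ^ l)"
  have e: "?e \<le> 2 ^ l" by (simp add: Suc_leI)
  show ?thesis
  proof (cases "odd (m div 2 ^ l)")
    case True
    then have "Suc (m mod 2 ^ Suc l) = ?e + 2 ^ l" unfolding mod_power_Suc by simp
    moreover from this have "2 ^ Suc l - Suc (m mod 2 ^ Suc l) = 2 ^ l - ?e" by simp
    ultimately show ?thesis using True by (simp only: power_add) simp
  next
    case False
    then have "Suc (m mod 2 ^ Suc l) = ?e" unfolding mod_power_Suc by simp
    moreover from this e have "2 ^ Suc l - Suc (m mod 2 ^ Suc l) = (2 ^ l - ?e) + 2 ^ l" by simp
    ultimately show ?thesis using False by (simp only: power_add) simp
  qed
qed

text \<open>Raising link \<open>l\<close> to the power \<open>2 ^ l\<close> contributes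
  \<open>2 ^ l\<close> factors of the variable selected by digit \<open>l\<close> of
  \<open>m\<close>; the induction multiplies these contributions.\<close>

lemma sqrt_chain_le:
  fixes g :: "nat \<Rightarrow> real" and m :: nat
  assumes "0 \<le> v"
    and nonneg: "\<And>l. l \<le> K \<Longrightarrow> 0 \<le> g l"
    and step: "\<And>l. l < K \<Longrightarrow> (g (Suc l))\<^sup>2 \<le> g l * (if odd (m div 2 ^ l) then g 0 else v)"
    and "l \<le> K"
  shows "g l ^ 2 ^ l \<le> g 0 ^ Suc (m mod 2 ^ l) * v ^ (2 ^ l - Suc (m mod 2 ^ l))"
  using \<open>l \<le> K\<close>
proof (induction l)
  case 0
  then show ?case by simp
next
  case (Suc l)
  let ?c = "if odd (m div 2 ^ l) then g 0 else v" and ?e = "Suc (m mod 2 ^ l)"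
  have c: "0 \<le> ?c" using assms(1) nonneg[of 0] by simp
  have "g (Suc l) ^ 2 ^ Suc l = ((g (Suc l))\<^sup>2) ^ 2 ^ l" by (simp add: power_mult)
  also have "\<dots> \<le> (g l * ?c) ^ 2 ^ l" using step[of l] Suc.prems by (intro power_mono) auto
  also have "\<dots> = g l ^ 2 ^ l * ?c ^ 2 ^ l" by (simp add: power_mult_distrib)
  also have "\<dots> \<le> (g 0 ^ ?e * v ^ (2 ^ l - ?e)) * ?c ^ 2 ^ l"
    using Suc c by (intro mult_right_mono) auto
  also have "\<dots> = g 0 ^ Suc (m mod 2 ^ Suc l) * v ^ (2 ^ Suc l - Suc (m mod 2 ^ Suc l))"
    by (rule sqrt_chain_exponents)
  finally show ?case .
qed

text \<open>The solution with equality in every link, used as the feasible witness.\<close>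

primrec sqrt_chain :: "nat \<Rightarrow> real \<Rightarrow> real \<Rightarrow> nat \<Rightarrow> real" where
  "sqrt_chain m b v 0 = b"
| "sqrt_chain m b v (Suc l) = sqrt (sqrt_chain m b v l * (if odd (m div 2 ^ l) then b else v))"

lemma sqrt_chain_nonneg: "0 \<le> b \<Longrightarrow> 0 \<le> v \<Longrightarrow> 0 \<le> sqrt_chain m b v l"
  by (induction l) auto

lemma sqrt_chain_power:
  assumes "0 \<le> b" "0 \<le> v"
  shows "sqrt_chain m b v l ^ 2 ^ l = b ^ Suc (m mod 2 ^ l) * v ^ (2 ^ l - Suc (m mod 2 ^ l))"
proof (induction l)
  case 0
  then show ?case by simp
next
  case (Suc l)
  let ?c = "if odd (m div 2 ^ l) then b else v" and ?e = "Suc (m mod 2 ^ l)"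
  have "sqrt_chain m b v (Suc l) ^ 2 ^ Suc l = ((sqrt_chain m b v (Suc l))\<^sup>2) ^ 2 ^ l"
    by (simp add: power_mult del: sqrt_chain.simps)
  also have "(sqrt_chain m b v (Suc l))\<^sup>2 = sqrt_chain m b v l * ?c"
    using sqrt_chain_nonneg[OF assms] assms by simp
  also have "\<dots> ^ 2 ^ l = sqrt_chain m b v l ^ 2 ^ l * ?c ^ 2 ^ l" by (simp add: power_mult_distrib)
  also have "\<dots> = (b ^ ?e * v ^ (2 ^ l - ?e)) * ?c ^ 2 ^ l"
    using Suc by simp
  also have "\<dots> = b ^ Suc (m mod 2 ^ Suc l) * v ^ (2 ^ Suc l - Suc (m mod 2 ^ Suc l))"
    by (rule sqrt_chain_exponents)
  finally show ?case .
qed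

section \<open>Power cones as lists of 2 x 2 blocks\<close>

definition sqrt_chain_cons :: "nat \<Rightarrow> nat \<Rightarrow> 'k \<Rightarrow> (nat \<Rightarrow> 'k) \<Rightarrow> ('k \<times> 'k \<times> 'k) list" where
  "sqrt_chain_cons K m v g =
     map (\<lambda>l. (g l, if odd (m div 2 ^ l) then g 0 else v, g (Suc l))) [0..<K]"

text \<open>Encodes \<open>v ^ (p + q) \<le> g 0 ^ p * h 0 ^ q\<close> by two chains joined in a
  last block. The digits are those of \<open>p - 1\<close> and \<open>q - 1\<close> because the
  start of each chain already supplies one factor.\<close>

definition power_cone_cons ::
  "nat \<Rightarrow> nat \<Rightarrow> nat \<Rightarrow> 'k \<Rightarrow> (nat \<Rightarrow> 'k) \<Rightarrow> (nat \<Rightarrow> 'k) \<Rightarrow> ('k \<times> 'k \<times> 'k) list" where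
  "power_cone_cons K p q v g h =
     sqrt_chain_cons K (p - 1) v g @ sqrt_chain_cons K (q - 1) v h @ [(g K, h K, v)]"

lemma length_power_cone_cons: "length (power_cone_cons K p q v g h) = 2 * K + 1"
  by (simp add: power_cone_cons_def sqrt_chain_cons_def)

text \<open>Multiply the two chain bounds, compare with the joining block raised to the power
  \<open>2 ^ K\<close>, and cancel the surplus powers of \<open>v\<close>.\<close>

lemma power_cone_of_cons:
  assumes pq: "1 \<le> p" "p \<le> 2 ^ K" "1 \<le> q" "q \<le> 2 ^ K" and v: "0 \<le> val v"
    and cons: "\<forall>(a, b, c)\<in>set (power_cone_cons K p q v g h). hyperbolic (val a) (val b) (val c)"
  shows "0 \<le> val (g 0)" "0 \<le> val (h 0)" "val v ^ (p + q) \<le> val (g 0) ^ p * val (h 0) ^ q"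
proof -
  have "hyperbolic (val (g l)) (val (if odd ((p - 1) div 2 ^ l) then g 0 else v)) (val (g (Suc l)))"
    "hyperbolic (val (h l)) (val (if odd ((q - 1) div 2 ^ l) then h 0 else v)) (val (h (Suc l)))"
    if "l < K" for l
    using cons that by (fastforce simp: power_cone_cons_def sqrt_chain_cons_def)+
  note links = this
  have chain: "0 \<le> val (g l)" "0 \<le> val (h l)"
      "(val (g (Suc l)))\<^sup>2 \<le> val (g l) * (if odd ((p - 1) div 2 ^ l) then val (g 0) else val v)"
      "(val (h (Suc l)))\<^sup>2 \<le> val (h l) * (if odd ((q - 1) div 2 ^ l) then val (h 0) else val v)"
    if "l < K" for l
    using links[OF that] by (auto simp: hyperbolic_def)
  have top: "0 \<le> val (g K)" "0 \<le> val (h K)" "(val v)\<^sup>2 \<le> val (g K) * val (h K)"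
    using cons by (auto simp: power_cone_cons_def hyperbolic_def)
  \<comment> \<open>Link \<open>l\<close> gives the sign of its first entry; the joining block gives
    the sign at \<open>K\<close>, also when there are no links.\<close>
  have nonneg: "0 \<le> val (g l)" "0 \<le> val (h l)" if "l \<le> K" for l
    using that chain top by (cases "l = K"; simp)+
  show g0: "0 \<le> val (g 0)" and h0: "0 \<le> val (h 0)" using nonneg by auto
  \<comment> \<open>Since \<open>p - 1 < 2 ^ K\<close>, all its binary digits are read within
    \<open>K\<close> steps.\<close>
  have mod: "Suc ((p - 1) mod 2 ^ K) = p" "Suc ((q - 1) mod 2 ^ K) = q" using pq by auto
  have "val (g K) ^ 2 ^ K \<le> val (g 0) ^ p * val v ^ (2 ^ K - p)"
    using nonneg chain
    by (intro sqrt_chain_le[where g = "\<lambda>l. val (g l)" and m = "p - 1" and l = K and K = K, OF v,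
          unfolded mod]) auto
  moreover have "val (h K) ^ 2 ^ K \<le> val (h 0) ^ q * val v ^ (2 ^ K - q)"
    using nonneg chain
    by (intro sqrt_chain_le[where g = "\<lambda>l. val (h l)" and m = "q - 1" and l = K and K = K, OF v,
          unfolded mod]) auto
  ultimately have "val (g K) ^ 2 ^ K * val (h K) ^ 2 ^ K
      \<le> (val (g 0) ^ p * val v ^ (2 ^ K - p)) * (val (h 0) ^ q * val v ^ (2 ^ K - q))"
    using top v g0 by (intro mult_mono) auto
  moreover have "((val v)\<^sup>2) ^ 2 ^ K \<le> (val (g K) * val (h K)) ^ 2 ^ K"
    using top by (intro power_mono) auto
  moreover have "((val v)\<^sup>2) ^ 2 ^ K = val v ^ (p + q) * (val v ^ (2 ^ K - p) * val v ^ (2 ^ K - q))"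
    using pq by (simp add: mult_2 flip: power_add power_mult)
  ultimately have le: "val v ^ (p + q) * (val v ^ (2 ^ K - p) * val v ^ (2 ^ K - q))
      \<le> (val (g 0) ^ p * val (h 0) ^ q) * (val v ^ (2 ^ K - p) * val v ^ (2 ^ K - q))"
    by (simp add: power_mult_distrib mult_ac)
  show "val v ^ (p + q) \<le> val (g 0) ^ p * val (h 0) ^ q"
  \<comment> \<open>Cancellation requires a positive \<open>v\<close>; at zero the left side
    vanishes because \<open>p + q > 0\<close>.\<close>
  proof (cases "val v = 0")
    case True
    then show ?thesis using pq g0 h0 by (simp add: power_0_left)
  next
    case False
    then show ?thesis using le v by (simp add: mult_le_cancel_right zero_less_mult_iff)
  qed
qed

text \<open>The links hold with equality by construction, so the cone inequality is spent only on
  the joining block, after taking \<open>2 ^ K\<close>-th roots.\<close>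

lemma power_cone_cons_of_sqrt_chain:
  assumes pq: "1 \<le> p" "p \<le> 2 ^ K" "1 \<le> q" "q \<le> 2 ^ K"
    and nonneg: "0 \<le> val v" "0 \<le> b" "0 \<le> c"
    and cone: "val v ^ (p + q) \<le> b ^ p * c ^ q"
    and g: "\<And>l. l \<le> K \<Longrightarrow> val (g l) = sqrt_chain (p - 1) b (val v) l"
    and h: "\<And>l. l \<le> K \<Longrightarrow> val (h l) = sqrt_chain (q - 1) c (val v) l"
  shows "\<forall>(a, b, c)\<in>set (power_cone_cons K p q v g h). hyperbolic (val a) (val b) (val c)"
proof -
  let ?G = "sqrt_chain (p - 1) b (val v)" and ?H = "sqrt_chain (q - 1) c (val v)"
  have G: "0 \<le> ?G l" and H: "0 \<le> ?H l" for l using sqrt_chain_nonneg nonneg by auto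
  have mod: "Suc ((p - 1) mod 2 ^ K) = p" "Suc ((q - 1) mod 2 ^ K) = q" using pq by auto
  have "((val v)\<^sup>2) ^ 2 ^ K = val v ^ (p + q) * (val v ^ (2 ^ K - p) * val v ^ (2 ^ K - q))"
    using pq by (simp add: mult_2 flip: power_add power_mult)
  also have "\<dots> \<le> (b ^ p * c ^ q) * (val v ^ (2 ^ K - p) * val v ^ (2 ^ K - q))"
    using cone nonneg by (intro mult_right_mono) auto
  also have "\<dots> = (?G K * ?H K) ^ 2 ^ K"
    unfolding power_mult_distrib sqrt_chain_power[OF nonneg(2,1)] sqrt_chain_power[OF nonneg(3,1)] mod
    by simp
  finally have "(val v)\<^sup>2 \<le> ?G K * ?H K"
    using G H by (simp add: power_mono_iff)
  then have "hyperbolic (val (g K)) (val (h K)) (val v)" using G H g h by (simp add: hyperbolic_def)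
  moreover have "hyperbolic (val (g l)) (val (if odd ((p - 1) div 2 ^ l) then g 0 else v)) (val (g (Suc l)))"
    "hyperbolic (val (h l)) (val (if odd ((q - 1) div 2 ^ l) then h 0 else v)) (val (h (Suc l)))"
    if "l < K" for l
    using that G H g[of l] g[of 0] g[of "Suc l"] h[of l] h[of 0] h[of "Suc l"] nonneg
    by (auto simp: hyperbolic_def)
  ultimately show ?thesis by (auto simp: power_cone_cons_def sqrt_chain_cons_def)
qed


section \<open>Norms by power cones\<close>

lemma ltau_norm_smult:
  assumes "0 < \<tau>" "0 \<le> c"
  shows "ltau_norm \<tau> (c \<cdot>\<^sub>v y) = c * ltau_norm \<tau> y"
proof -
  have "(\<Sum>j<dim_vec y. \<bar>(c \<cdot>\<^sub>v y) $ j\<bar> powr \<tau>) = c powr \<tau> * (\<Sum>j<dim_vec y. \<bar>y $ j\<bar> powr \<tau>)"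
    using assms unfolding sum_distrib_left by (intro sum.cong) (simp_all add: abs_mult powr_mult)
  then have "ltau_norm \<tau> (c \<cdot>\<^sub>v y) = (c powr \<tau>) powr (1 / \<tau>) * ltau_norm \<tau> y"
    by (simp add: ltau_norm_def powr_mult)
  then show ?thesis
    using assms by (simp add: powr_powr)
qed

lemma ltau_norm_nonneg: "0 \<le> ltau_norm \<tau> y"
  by (simp add: ltau_norm_def)

lemma ltau_norm_powr:
  assumes "0 < \<tau>"
  shows "ltau_norm \<tau> y powr \<tau> = (\<Sum>j<dim_vec y. \<bar>y $ j\<bar> powr \<tau>)"
  using assms by (simp add: ltau_norm_def powr_powr sum_nonneg)

text \<open>Take \<open>s\<close>-th roots of both sides, a monotone operation on nonnegative
  reals.\<close>

lemma power_cone_iff_powr: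
  fixes r s :: nat
  assumes "0 < s" "s < r" "0 \<le> v" "0 \<le> b" "0 \<le> t"
  shows "v ^ r \<le> b ^ s * t ^ (r - s) \<longleftrightarrow> v powr (real r / real s) \<le> b * t powr (real r / real s - 1)"
proof -
  let ?e = "1 / real s"
  have e: "0 < ?e" "real r * ?e = real r / real s" "real s * ?e = 1"
      "real (r - s) * ?e = real r / real s - 1"
    using assms(1,2) by (simp_all add: of_nat_diff diff_divide_distrib)
  have root: "(y ^ k) powr ?e = y powr (real k * ?e)" if "0 \<le> y" "0 < k" for y k
  proof (cases "y = 0")
    case False
    then have "y ^ k = y powr real k" using that by (simp only: powr_realpow)
    then show ?thesis by (simp only: powr_powr)
  qed (use that in simp)
  have mono: "X \<le> Y \<longleftrightarrow> X powr ?e \<le> Y powr ?e" if "0 \<le> X" "0 \<le> Y" for X Y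
  proof
    show "X powr ?e \<le> Y powr ?e" if "X \<le> Y"
      using e(1) \<open>0 \<le> X\<close> that by (intro powr_mono2) auto
  next
    show "X \<le> Y" if "X powr ?e \<le> Y powr ?e"
      using powr_less_mono2[OF e(1) \<open>0 \<le> Y\<close>, of X] that by (rule_tac leI) (metis not_le)
  qed
  have rhs: "(b ^ s * t ^ (r - s)) powr ?e = b * t powr (real r / real s - 1)"
    unfolding powr_mult using root[of b s] root[of t "r - s"] assms e(3,4) by (metis powr_one zero_less_diff)
  have "v ^ r \<le> b ^ s * t ^ (r - s) \<longleftrightarrow> (v ^ r) powr ?e \<le> (b ^ s * t ^ (r - s)) powr ?e"
    using assms by (intro mono) auto
  also have "(v ^ r) powr ?e = v powr (real r / real s)"
    using root[of v r] assms(1-3) e(2) by (metis less_trans)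
  finally show ?thesis unfolding rhs .
qed

text \<open>Summing the cones in their \<open>powr\<close> form bounds the sum of the powers
  \<open>\<bar>y $ j\<bar> powr \<tau>\<close> by
  \<open>t * t powr (\<tau> - 1) = t powr \<tau>\<close>.\<close>

lemma ltau_norm_le_of_power_cones:
  fixes r s :: nat
  assumes rs: "0 < s" "s < r" and \<tau>: "\<tau> = real r / real s" and "0 \<le> t"
    and "\<And>j. j < dim_vec y \<Longrightarrow> \<bar>y $ j\<bar> \<le> v j \<and> 0 \<le> b j \<and> v j ^ r \<le> b j ^ s * t ^ (r - s)"
    and sum: "(\<Sum>j<dim_vec y. b j) \<le> t"
  shows "ltau_norm \<tau> y \<le> t"
proof -
  have "1 < \<tau>" using rs by (simp add: \<tau>)
  have "\<bar>y $ j\<bar> powr \<tau> \<le> b j * t powr (\<tau> - 1)" if "j < dim_vec y" for j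
  proof -
    have "\<bar>y $ j\<bar> powr \<tau> \<le> v j powr \<tau>" using assms(5)[OF that] \<open>1 < \<tau>\<close> by (intro powr_mono2) auto
    also have "\<dots> \<le> b j * t powr (\<tau> - 1)"
      using power_cone_iff_powr[OF rs, of "v j" "b j" t] assms(5)[OF that] \<open>0 \<le> t\<close> 
      by (auto simp: \<tau>)
    finally show ?thesis .
  qed
  then have "ltau_norm \<tau> y powr \<tau> \<le> (\<Sum>j<dim_vec y. b j) * t powr (\<tau> - 1)"
    using \<open>1 < \<tau>\<close> by (auto simp: ltau_norm_powr sum_distrib_right intro!: sum_mono)
  also have "\<dots> \<le> t * t powr (\<tau> - 1)" using sum by (intro mult_right_mono) auto
  also have "\<dots> = t powr \<tau>" using \<open>0 \<le> t\<close> \<open>1 < \<tau>\<close> by (cases "t = 0") (auto simp: powr_diff)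
  finally show ?thesis
    using powr_less_mono2[of \<tau> t "ltau_norm \<tau> y"] \<open>1 < \<tau>\<close> \<open>0 \<le> t\<close> by linarith
qed

text \<open>The norm is divided among the coordinates in proportion to
  \<open>\<bar>y $ j\<bar> powr \<tau>\<close>, which makes every cone tight.\<close>

lemma power_cones_of_ltau_norm:
  fixes r s :: nat
  assumes rs: "0 < s" "s < r" and \<tau>: "\<tau> = real r / real s"
  obtains b where "\<And>j. j < dim_vec y \<Longrightarrow> 0 \<le> b j \<and> \<bar>y $ j\<bar> ^ r \<le> b j ^ s * ltau_norm \<tau> y ^ (r - s)"
    and "(\<Sum>j<dim_vec y. b j) \<le> ltau_norm \<tau> y"
proof -
  let ?t = "ltau_norm \<tau> y"
  have "1 < \<tau>" using rs by (simp add: \<tau>)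
  note norm = ltau_norm_powr[of \<tau> y] 
  \<comment> \<open>For \<open>?t = 0\<close> all entries vanish and division by zero gives the required zeros.\<close>
  define b where "b j = \<bar>y $ j\<bar> powr \<tau> / ?t powr (\<tau> - 1)" for j
  show thesis
  proof
    fix j assume j: "j < dim_vec y"
    have b: "0 \<le> b j" by (simp add: b_def)
    have "\<bar>y $ j\<bar> powr \<tau> \<le> b j * ?t powr (\<tau> - 1)"
    proof (cases "?t = 0")
      case True
      then have "\<bar>y $ j\<bar> powr \<tau> = 0"
        using norm \<open>1 < \<tau>\<close> j by (simp add: sum_nonneg_eq_0_iff)
      then show ?thesis using b by simp
    next
      case False
      then show ?thesis by (simp add: b_def)
    qed
    then show "0 \<le> b j \<and> \<bar>y $ j\<bar> ^ r \<le> b j ^ s * ?t ^ (r - s)"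
      using power_cone_iff_powr[OF rs, of "\<bar>y $ j\<bar>" "b j" ?t] b ltau_norm_nonneg by (auto simp: \<tau>)
  next
    have "(\<Sum>j<dim_vec y. b j) = ?t powr \<tau> / ?t powr (\<tau> - 1)"
      using norm \<open>1 < \<tau>\<close> by (simp add: b_def sum_divide_distrib)
    also have "\<dots> \<le> ?t"
      using ltau_norm_nonneg[of \<tau> y] powr_diff[of ?t \<tau> "\<tau> - 1"] by (cases "?t = 0") auto
    finally show "(\<Sum>j<dim_vec y. b j) \<le> ?t" .
  qed
qed

text \<open>Both exponents \<open>s\<close> and \<open>r - s\<close> are at most
  \<open>r - 1\<close>, hence the bound \<open>2 ^ K + 1\<close>. For the least such
  \<open>K = Suc k\<close>, minimality gives \<open>k \<le> log 2 r\<close>, and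
  \<open>2 * k + 3 \<le> 4 * k\<close> once \<open>k \<ge> 2\<close>; smaller \<open>K\<close> are
  checked directly.\<close>

lemma chain_length_exists:
  fixes r :: nat
  assumes "2 \<le> r"
  obtains K where "r \<le> 2 ^ K + 1" "real (2 * K + 1) \<le> 4 * log 2 (real r)"
proof -
  define K where "K = (LEAST K. r \<le> 2 ^ K + 1)"
  have ex: "r \<le> 2 ^ r + 1" by (simp add: le_SucI less_imp_le_nat)
  have K: "r \<le> 2 ^ K + 1" unfolding K_def using ex by (rule LeastI[of "\<lambda>K. r \<le> 2 ^ K + 1"])
  have log: "k \<le> log 2 (real r)" if "2 ^ k \<le> r" for k :: nat
    using that by (intro le_log_of_power) auto
  have "real (2 * K + 1) \<le> 4 * log 2 (real r)"
  proof (cases K)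
    case 0
    have "1 \<le> log 2 (real r)" using assms by simp
    then show ?thesis using 0 by simp
  next
    case (Suc k)
    then have "\<not> r \<le> 2 ^ k + 1" using not_less_Least[of k "\<lambda>K. r \<le> 2 ^ K + 1"] by (simp add: K_def)
    then have r: "2 ^ k + 2 \<le> r" by simp
    show ?thesis
    proof (cases "k \<le> 1")
      case True
      then consider "k = 0" | "k = 1" by linarith
      then show ?thesis
      proof cases
        case 1
        have "1 \<le> log 2 (real r)" using assms by simp
        then show ?thesis using 1 Suc by simp
      next
        case 2
        then have "2 \<le> log 2 (real r)" using log[of 2] r by simp
        then show ?thesis using 2 Suc by simp
      qed
    next
      case False
      have "real k \<le> log 2 (real r)" using log[of k] r by simp
      then show ?thesis using False Suc by simp
    qed
  qed
  with K show thesis by (rule that)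
qed


section \<open>The ordered median program\<close>

text \<open>\<open>Epi i\<close> bounds a weighted distance, \<open>DualU\<close> and
  \<open>DualW\<close> are the assignment potentials, \<open>Dev i j\<close> bounds a weighted
  coordinate difference, and \<open>Share i j\<close> is the part of \<open>Epi i\<close> given to
  coordinate \<open>j\<close>. The chain names are the intermediate geometric means.\<close>

datatype aux = Epi nat | DualU nat | DualW nat | Dev nat nat | Share nat nat
  | ShareChain nat nat nat | EpiChain nat nat nat

text \<open>The three groups have \<open>n^2\<close>, \<open>2 * n * d\<close> and \<open>n\<close>
  members. Signs cost no linear constraint: they follow from the blocks or from the absolute value
  bounds.\<close>

definition median_lin :: "nat \<Rightarrow> nat \<Rightarrow> (nat \<Rightarrow> real vec) \<Rightarrow> (nat \<Rightarrow> real) \<Rightarrow> (nat \<Rightarrow> real) \<Rightarrow>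
    ((real \<times> (nat + aux)) list \<times> real) list" where
  "median_lin n d a \<omega> lam =
     concat (map (\<lambda>i. map (\<lambda>k.
       ([(1, Inr (DualU i)), (1, Inr (DualW k)), (- lam k, Inr (Epi i))], 0)) [1..<Suc n]) [1..<Suc n]) @
     concat (map (\<lambda>i. concat (map (\<lambda>j.
       [([(1, Inr (Dev i j)), (- \<omega> i, Inl j)], \<omega> i * a i $ j),
        ([(1, Inr (Dev i j)), (\<omega> i, Inl j)], - \<omega> i * a i $ j)]) [0..<d])) [1..<Suc n]) @
     map (\<lambda>i. ((1, Inr (Epi i)) # map (\<lambda>j. (- 1, Inr (Share i j))) [0..<d], 0)) [1..<Suc n]"

text \<open>Index 0 of each chain is the original variable, so all coordinates \<open>j\<close>
  share the same \<open>Epi i\<close>, while later links belong to a single pair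
  \<open>(i, j)\<close>.\<close>

definition cone_cons :: "nat \<Rightarrow> nat \<Rightarrow> nat \<Rightarrow> nat \<Rightarrow> nat \<Rightarrow> ((nat + aux) \<times> (nat + aux) \<times> (nat + aux)) list" where
  "cone_cons K p q i j = power_cone_cons K p q (Inr (Dev i j))
     (\<lambda>l. Inr (if l = 0 then Share i j else ShareChain i j l))
     (\<lambda>l. Inr (if l = 0 then Epi i else EpiChain i j l))"

definition median_psd :: "nat \<Rightarrow> nat \<Rightarrow> nat \<Rightarrow> nat \<Rightarrow> nat \<Rightarrow> ((nat + aux) \<times> (nat + aux) \<times> (nat + aux)) list" where
  "median_psd n d K p q =
     concat (map (\<lambda>i. concat (map (\<lambda>j. cone_cons K p q i j) [0..<d])) [1..<Suc n])"

definition median_obj :: "nat \<Rightarrow> (real \<times> (nat + aux)) list" where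
  "median_obj n = map (\<lambda>i. (1, Inr (DualU i))) [1..<Suc n] @ map (\<lambda>k. (1, Inr (DualW k))) [1..<Suc n]"

lemma length_median_lin: "length (median_lin n d a \<omega> lam) = n\<^sup>2 + n * (2 * d + 1)"
  by (simp add: median_lin_def length_concat o_def sum_list_triv power2_eq_square algebra_simps
      del: upt_Suc)

lemma length_median_psd: "length (median_psd n d K p q) = n * d * (2 * K + 1)"
  by (simp add: median_psd_def cone_cons_def length_power_cone_cons length_concat o_def sum_list_triv
      algebra_simps del: upt_Suc)

lemma form_eval_median_obj:
  "form_eval val (median_obj n, 0) =
     (\<Sum>i=1..n. val (Inr (DualU i))) + (\<Sum>k=1..n. val (Inr (DualW k)))"
proof -
  have "(\<Sum>i\<leftarrow>[1..<Suc n]. g i) = (\<Sum>i=1..n. g i)" for g :: "nat \<Rightarrow> real"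
    by (simp add: interv_sum_list_conv_sum_set_nat atLeastLessThanSuc_atLeastAtMost del: upt_Suc)
  from this[of "\<lambda>i. val (Inr (DualU i))"] this[of "\<lambda>k. val (Inr (DualW k))"] show ?thesis
    by (simp add: form_eval_def median_obj_def o_def del: upt_Suc)
qed

lemma feasible_values_median:
  "feasible_values (median_lin n d a \<omega> lam) (median_psd n d K p q) val \<longleftrightarrow>
     (\<forall>i\<in>{1..n}. \<forall>k\<in>{1..n}. lam k * val (Inr (Epi i)) \<le> val (Inr (DualU i)) + val (Inr (DualW k))) \<and>
     (\<forall>i\<in>{1..n}. \<forall>j<d. \<bar>\<omega> i * (val (Inl j) - a i $ j)\<bar> \<le> val (Inr (Dev i j))) \<and>
     (\<forall>i\<in>{1..n}. (\<Sum>j<d. val (Inr (Share i j))) \<le> val (Inr (Epi i))) \<and>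
     (\<forall>i\<in>{1..n}. \<forall>j<d. \<forall>(b, c, w)\<in>set (cone_cons K p q i j). hyperbolic (val b) (val c) (val w))"
  (is "_ \<longleftrightarrow> ?dual \<and> ?dev \<and> ?sum \<and> ?cone")
proof -
  have set: "set [1..<Suc n] = {1..n}" by auto
  have upt: "{Suc 0..<Suc n} = {Suc 0..n}" by auto
  have ball: "(\<forall>j\<in>{0..<d}. Q j) \<longleftrightarrow> (\<forall>j<d. Q j)" for Q by auto
  have sum: "(\<Sum>j\<leftarrow>[0..<d]. - val (Inr (Share i j))) = - (\<Sum>j<d. val (Inr (Share i j)))" for i
    by (simp add: interv_sum_list_conv_sum_set_nat sum_negf atLeast0LessThan)
  have abs: "\<bar>\<omega> i * (y - a i $ j)\<bar> \<le> v \<longleftrightarrow>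
      0 \<le> v + - \<omega> i * y + \<omega> i * a i $ j \<and> 0 \<le> v + \<omega> i * y + - \<omega> i * a i $ j" for i j and y v :: real
    unfolding abs_le_iff right_diff_distrib by linarith
  have "(\<forall>g\<in>set (median_lin n d a \<omega> lam). 0 \<le> form_eval val g) \<longleftrightarrow> ?dual \<and> ?dev \<and> ?sum"
    unfolding median_lin_def abs set_append set_concat set_map set ball_Un
    by (simp add: form_eval_def o_def sum ball upt algebra_simps del: upt_Suc)
  moreover have "(\<forall>(b, c, w)\<in>set (median_psd n d K p q). hyperbolic (val b) (val c) (val w)) \<longleftrightarrow> ?cone"
    unfolding median_psd_def set_concat set_map set by (simp add: ball)
  ultimately show ?thesis unfolding feasible_values_def by blast
qed

text \<open>The coordinates of \<open>x\<close> enter through linear constraints only.\<close>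

lemma cone_cons_vars:
  assumes "(b, c, w) \<in> set (cone_cons K p q i j)"
  shows "b \<in> range Inr" "c \<in> range Inr" "w \<in> range Inr"
  using assms by (auto simp: cone_cons_def power_cone_cons_def sqrt_chain_cons_def)

theorem mainTheorem2:
  fixes n d r s :: nat
    and a :: "nat \<Rightarrow> real vec"
    and \<omega> lam :: "nat \<Rightarrow> real"
    and \<tau> :: real
  assumes "1 \<le> n" and "1 \<le> d"
    and "\<forall>i\<in>{1..n}. a i \<in> carrier_vec d"
    and "\<forall>i\<in>{1..n}. 0 \<le> \<omega> i"
    and "\<forall>i\<in>{1..n}. \<forall>j\<in>{1..n}. i \<le> j \<longrightarrow> lam j \<le> lam i"
    and "\<forall>i\<in>{1..n}. 0 \<le> lam i"
    and "0 < r" and "0 < s" and "s < r" and "coprime r s"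
    and "\<tau> = real r / real s"
  shows "\<exists>P. wf_sdp P \<and> sdp_represents d (ordered_median n \<tau> a \<omega> lam) P \<and>
     length (linear_cons P) = n^2 + n * (2 * d + 1) \<and>
     real (length (psd_cons P)) \<le> 4 * real n * real d * log 2 (real r)"
proof -
  have "0 < \<tau>" using assms(8,9,11) by simp
  obtain K where K: "r \<le> 2 ^ K + 1" "real (2 * K + 1) \<le> 4 * log 2 (real r)"
    using chain_length_exists[of r] assms(8,9) by auto
  have sK: "1 \<le> s" "s \<le> 2 ^ K" "1 \<le> r - s" "r - s \<le> 2 ^ K" "s + (r - s) = r"
    using K(1) assms(8,9) by auto
  let ?lin = "median_lin n d a \<omega> lam" and ?psd = "median_psd n d K s (r - s)"
  \<comment> \<open>The nonnegative weight is moved into the vector, so that the weighted distance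
    is itself a norm.\<close>
  define y where "y x i = \<omega> i \<cdot>\<^sub>v (x - a i)" for x i
  define N where "N x i = ltau_norm \<tau> (y x i)" for x i
  have N: "N x i = \<omega> i * ltau_norm \<tau> (x - a i)" if "i \<in> {1..n}" for x i
    using assms(4) that \<open>0 < \<tau>\<close> by (simp add: N_def y_def ltau_norm_smult)
  have y: "dim_vec (y x i) = d" "\<And>j. j < d \<Longrightarrow> y x i $ j = \<omega> i * (x $ j - a i $ j)"
    if "i \<in> {1..n}" for x i
    using bspec[OF assms(3) that] by (auto simp: y_def)
  have sorted: "\<exists>\<sigma>. sorts_desc n (N x) \<sigma> \<and>
      ordered_median n \<tau> a \<omega> lam x = (\<Sum>k=1..n. lam k * N x (\<sigma> k))" for x
  proof -
    obtain \<sigma> where \<sigma>: "sorts_desc n (\<lambda>i. \<omega> i * ltau_norm \<tau> (x - a i)) \<sigma>"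
      using sorts_desc_exists by blast
    then have perm: "\<sigma> permutes {1..n}" by (simp add: sorts_desc_def)
    have N\<sigma>: "N x (\<sigma> k) = \<omega> (\<sigma> k) * ltau_norm \<tau> (x - a (\<sigma> k))" if "k \<in> {1..n}" for k
      using N permutes_in_image[OF perm] that by blast
    then have "sorts_desc n (N x) \<sigma>" using \<sigma> by (simp add: sorts_desc_def)
    moreover have "ordered_median n \<tau> a \<omega> lam x = (\<Sum>k=1..n. lam k * N x (\<sigma> k))"
      unfolding ordered_median_eq[OF \<sigma>] using N\<sigma> by (intro sum.cong) auto
    ultimately show ?thesis by blast
  qed
  have "\<exists>P. wf_sdp P \<and> sdp_represents d (ordered_median n \<tau> a \<omega> lam) P \<and>
      length (linear_cons P) = length ?lin \<and> length (psd_cons P) = length ?psd"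
  proof (rule sdp_representation_of_named_program[where obj = "median_obj n"])
    fix j :: nat
    assume "Inl j \<in> (\<Union>g\<in>set ?lin. snd ` set (fst g)) \<union> (\<Union>(p, q, w)\<in>set ?psd. {p, q, w}) \<union>
        snd ` set (median_obj n)"
    moreover have "Inl j \<notin> (\<Union>(p, q, w)\<in>set ?psd. {p, q, w})"
      unfolding median_psd_def using cone_cons_vars by fastforce
    moreover have "Inl j \<notin> snd ` set (median_obj n)" by (auto simp: median_obj_def)
    ultimately show "j < d" by (auto simp: median_lin_def simp del: upt_Suc)
  next
    fix x :: "real vec" and e :: "aux \<Rightarrow> real"
    let ?val = "case_sum (($) x) e"
    assume feas: "feasible_values ?lin ?psd ?val"
    note fv = feas[unfolded feasible_values_median]
    have dual: "lam k * e (Epi i) \<le> e (DualU i) + e (DualW k)" if "i \<in> {1..n}" "k \<in> {1..n}" for i k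
      using conjunct1[OF fv] that by simp
    have dev: "\<bar>\<omega> i * (x $ j - a i $ j)\<bar> \<le> e (Dev i j)" if "i \<in> {1..n}" "j < d" for i j
      using conjunct1[OF conjunct2[OF fv]] that by simp
    have share: "(\<Sum>j<d. e (Share i j)) \<le> e (Epi i)" if "i \<in> {1..n}" for i
      using conjunct1[OF conjunct2[OF conjunct2[OF fv]]] that by simp
    have cone: "0 \<le> e (Share i j) \<and> 0 \<le> e (Epi i) \<and>
        e (Dev i j) ^ r \<le> e (Share i j) ^ s * e (Epi i) ^ (r - s)" if i: "i \<in> {1..n}" and j: "j < d" for i j
    proof -
      have "0 \<le> ?val (Inr (Dev i j))" using dev[OF i j] by simp
      moreover have "\<forall>(b, c, w)\<in>set (cone_cons K s (r - s) i j). hyperbolic (?val b) (?val c) (?val w)"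
        using conjunct2[OF conjunct2[OF conjunct2[OF fv]]] i j by blast
      ultimately show ?thesis
        unfolding cone_cons_def using power_cone_of_cons[OF sK(1-4), of ?val "Inr (Dev i j)"
            "\<lambda>l. Inr (if l = 0 then Share i j else ShareChain i j l)"
            "\<lambda>l. Inr (if l = 0 then Epi i else EpiChain i j l)"]
        by (simp add: sK(5))
    qed
    have le: "N x i \<le> e (Epi i)" if i: "i \<in> {1..n}" for i
      unfolding N_def
    proof (rule ltau_norm_le_of_power_cones[OF assms(8,9,11)])
      \<comment> \<open>The sign is read off a cone block of coordinate 0, which exists because
        \<open>1 \<le> d\<close>.\<close>
      show "0 \<le> e (Epi i)" using cone[OF i, of 0] assms(2) by simp
      show "(\<Sum>j<dim_vec (y x i). e (Share i j)) \<le> e (Epi i)" using share[OF i] y[OF i] by simp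
      show "\<bar>y x i $ j\<bar> \<le> e (Dev i j) \<and> 0 \<le> e (Share i j) \<and>
          e (Dev i j) ^ r \<le> e (Share i j) ^ s * e (Epi i) ^ (r - s)" if "j < dim_vec (y x i)" for j
      proof -
        have "j < d" using that y(1)[OF i] by simp
        then show ?thesis using dev[OF i] cone[OF i] y(2)[OF i] by simp
      qed
    qed
    obtain \<sigma> where \<sigma>: "sorts_desc n (N x) \<sigma>"
        "ordered_median n \<tau> a \<omega> lam x = (\<Sum>k=1..n. lam k * N x (\<sigma> k))"
      using sorted by blast
    then have perm: "\<sigma> permutes {1..n}" by (simp add: sorts_desc_def)
    \<comment> \<open>Here \<open>\<sigma>\<close> sorts the true distances and need not sort their
      bounds \<open>Epi\<close>; weak duality holds for it all the same.\<close>
    have "(\<Sum>k=1..n. lam k * N x (\<sigma> k)) \<le> (\<Sum>k=1..n. lam k * e (Epi (\<sigma> k)))"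
    proof (intro sum_mono mult_left_mono)
      fix k assume "k \<in> {1..n}"
      then show "N x (\<sigma> k) \<le> e (Epi (\<sigma> k))" "0 \<le> lam k"
        using le permutes_in_image[OF perm] assms(6) by blast+
    qed
    also have "\<dots> \<le> (\<Sum>i=1..n. e (DualU i)) + (\<Sum>k=1..n. e (DualW k))"
      by (rule ordered_sum_le_assignment_dual[OF perm dual])
    finally show "ordered_median n \<tau> a \<omega> lam x \<le> form_eval ?val (median_obj n, 0)"
      by (simp add: \<sigma>(2) form_eval_median_obj)
  next
    fix x :: "real vec"
    obtain \<sigma> where \<sigma>: "sorts_desc n (N x) \<sigma>"
        "ordered_median n \<tau> a \<omega> lam x = (\<Sum>k=1..n. lam k * N x (\<sigma> k))"
      using sorted by blast
    obtain u w where uw: "\<And>i k. i \<in> {1..n} \<Longrightarrow> k \<in> {1..n} \<Longrightarrow> lam k * N x i \<le> u i + w k"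
        "(\<Sum>i=1..n. u i) + (\<Sum>k=1..n. w k) = (\<Sum>k=1..n. lam k * N x (\<sigma> k))"
      using assignment_dual_attained[OF assms(5) \<sigma>(1)] by blast
    have "\<exists>b. (\<forall>j<dim_vec (y x i). 0 \<le> b j \<and> \<bar>y x i $ j\<bar> ^ r \<le> b j ^ s * N x i ^ (r - s)) \<and>
        (\<Sum>j<dim_vec (y x i). b j) \<le> N x i" for i
      unfolding N_def by (rule power_cones_of_ltau_norm[OF assms(8,9,11), of "y x i"]) blast
    then obtain b where b: "\<And>i j. j < dim_vec (y x i) \<Longrightarrow> 0 \<le> b i j"
        "\<And>i j. j < dim_vec (y x i) \<Longrightarrow> \<bar>y x i $ j\<bar> ^ r \<le> b i j ^ s * N x i ^ (r - s)"
        "\<And>i. (\<Sum>j<dim_vec (y x i). b i j) \<le> N x i"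
      by metis
    \<comment> \<open>Distances and absolute values are taken exactly, with optimal potentials, the
      shares \<open>b\<close>, and chains of equalities.\<close>
    define e where "e k = (case k of
        Epi i \<Rightarrow> N x i | DualU i \<Rightarrow> u i | DualW k \<Rightarrow> w k | Dev i j \<Rightarrow> \<bar>y x i $ j\<bar> | Share i j \<Rightarrow> b i j
      | ShareChain i j l \<Rightarrow> sqrt_chain (s - 1) (b i j) \<bar>y x i $ j\<bar> l
      | EpiChain i j l \<Rightarrow> sqrt_chain (r - s - 1) (N x i) \<bar>y x i $ j\<bar> l)" for k
    let ?val = "case_sum (($) x) e"
    have cone: "\<forall>(b, c, w)\<in>set (cone_cons K s (r - s) i j). hyperbolic (?val b) (?val c) (?val w)"
      if "i \<in> {1..n}" "j < d" for i j
      unfolding cone_cons_def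
      by (rule power_cone_cons_of_sqrt_chain[OF sK(1-4), of _ _ "b i j" "N x i"])
        (use b[where i = i] y[OF that(1)] that sK(5) ltau_norm_nonneg in \<open>auto simp: e_def N_def\<close>)
    have "feasible_values ?lin ?psd ?val"
      unfolding feasible_values_median
    proof (intro conjI)
      show "\<forall>i\<in>{1..n}. \<forall>j<d. \<forall>(b, c, w)\<in>set (cone_cons K s (r - s) i j).
          hyperbolic (?val b) (?val c) (?val w)"
        using cone by blast
    next
      show "\<forall>i\<in>{1..n}. (\<Sum>j<d. ?val (Inr (Share i j))) \<le> ?val (Inr (Epi i))"
      proof
        fix i assume "i \<in> {1..n}"
        then show "(\<Sum>j<d. ?val (Inr (Share i j))) \<le> ?val (Inr (Epi i))"
          using b(3)[of i] y(1)[of i x] by (simp add: e_def)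
      qed
    qed (use uw(1) y(2) in \<open>auto simp: e_def\<close>)
    moreover have "form_eval ?val (median_obj n, 0) \<le> ordered_median n \<tau> a \<omega> lam x"
      using uw(2) by (simp add: \<sigma>(2) form_eval_median_obj e_def)
    ultimately show "\<exists>e. feasible_values ?lin ?psd (case_sum (($) x) e) \<and>
        form_eval (case_sum (($) x) e) (median_obj n, 0) \<le> ordered_median n \<tau> a \<omega> lam x"
      by blast
  qed
  moreover have "real (n * d * (2 * K + 1)) \<le> 4 * real n * real d * log 2 (real r)"
    using mult_left_mono[OF K(2), of "real (n * d)"] by (simp add: algebra_simps)
  ultimately show ?thesis by (simp only: length_median_lin length_median_psd) metis
qed

end
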